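(* Let $A, B, C\subset\mathbb{R}$ be three pairwise disjoint intervals with $|A|=\tfrac12$ and $|B|=|C|=\tfrac14$, and let $\Omega=A\cup B\cup C$. If $\Omega$ is a spectral set, then $\Omega$ tiles $\mathbb{R}$ by translations.
   Context: $|\cdot|$ denotes Lebesgue measure (length). A measurable set $\Omega\subset\mathbb{R}$ of finite positive measure is a spectral set if there is a subset $\Lambda\subset\mathbb{R}$ such that the functions $e_\lambda(x)=|\Omega|^{-1/2}e^{2\pi i\lambda x}\chi_\Omega(x)$, $\lambda\in\Lambda$, form an orthonormal basis of $L^2(\Omega)$. $\Omega$ tiles $\mathbb{R}$ by translations if there is a subset $\mathcal{T}\subset\mathbb{R}$ such that the translates $\{\Omega+t : t\in\mathcal{T}\}$ form a partition of $\mathbb{R}$ up to sets of measure zero. *)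

theory Defs
  imports "HOL-Analysis.Analysis"
begin

text \<open>The space of complex square-integrable functions over a measure space. Its elements are
  functions rather than classes modulo equality almost everywhere, so \<open>L2_norm\<close> is a seminorm;
  orthonormality and density of the span do not depend on the choice of representatives.\<close>

definition L2_space :: "'a measure \<Rightarrow> ('a \<Rightarrow> complex) set" where
  "L2_space M = {f \<in> borel_measurable M. integrable M (\<lambda>x. (cmod (f x))\<^sup>2)}"

definition L2_inner :: "'a measure \<Rightarrow> ('a \<Rightarrow> complex) \<Rightarrow> ('a \<Rightarrow> complex) \<Rightarrow> complex" where
  "L2_inner M f g = (LINT x|M. f x * cnj (g x))"

definition L2_norm :: "'a measure \<Rightarrow> ('a \<Rightarrow> complex) \<Rightarrow> real" where
  "L2_norm M f = sqrt (LINT x|M. (cmod (f x))\<^sup>2)"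

definition orthonormal_basis_L2 :: "'a measure \<Rightarrow> ('i \<Rightarrow> 'a \<Rightarrow> complex) \<Rightarrow> 'i set \<Rightarrow> bool" where
  "orthonormal_basis_L2 M e I \<longleftrightarrow>
     (\<forall>i\<in>I. e i \<in> L2_space M) \<and>
     (\<forall>i\<in>I. \<forall>j\<in>I. L2_inner M (e i) (e j) = (if i = j then 1 else 0)) \<and>
     (\<forall>f\<in>L2_space M. \<forall>\<epsilon>>0. \<exists>F c. finite F \<and> F \<subseteq> I \<and>
        L2_norm M (\<lambda>x. f x - (\<Sum>i\<in>F. c i * e i x)) < \<epsilon>)"

definition exponential_on :: "real set \<Rightarrow> real \<Rightarrow> real \<Rightarrow> complex" where
  "exponential_on \<Omega> l x =
     of_real (measure lebesgue \<Omega> powr (-1/2)) * exp (2 * of_real pi * \<i> * of_real l * of_real x)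
       * indicator \<Omega> x"

definition spectral_set :: "real set \<Rightarrow> bool" where
  "spectral_set \<Omega> \<longleftrightarrow>
     \<Omega> \<in> sets lebesgue \<and> 0 < emeasure lebesgue \<Omega> \<and> emeasure lebesgue \<Omega> < \<infinity> \<and>
     (\<exists>\<Lambda>. orthonormal_basis_L2 (lebesgue_on \<Omega>) (exponential_on \<Omega>) \<Lambda>)"

definition tiles_by_translations :: "real set \<Rightarrow> bool" where
  "tiles_by_translations \<Omega> \<longleftrightarrow>
     (\<exists>T::real set.
        (\<forall>s\<in>T. \<forall>t\<in>T. s \<noteq> t \<longrightarrow> (+) s ` \<Omega> \<inter> (+) t ` \<Omega> \<in> null_sets lebesgue) \<and>
        UNIV - (\<Union>t\<in>T. (+) t ` \<Omega>) \<in> null_sets lebesgue)"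

end

theory Submission imports Defs begin

text \<open>Let \<open>\<Lambda>\<close> be a spectrum of \<open>\<Omega>\<close>. Cut \<open>\<Omega>\<close>
  into four quarters of length \<open>1/4\<close>, two of them from \<open>A\<close>, with left endpoints
  \<open>0, 1/4, \<alpha>/4, \<beta>/4\<close> after a translation. At a difference of two frequencies the Fourier
  transform of \<open>\<Omega>\<close> vanishes. Outside \<open>2 \<int>\<close> this means that four unit
  numbers, the phases of the quarters, have sum zero; they cancel in pairs, and as the two halves of
  \<open>A\<close> do not cancel each other, \<open>B\<close> cancels one of them and \<open>C\<close> the
  other (\<open>integral_character_eq_0_imp_cancels\<close>). Each of the two possible pairings is a
  condition that certain numbers are odd integers.

  Parity now shows that \<open>\<Lambda>\<close> meets at most two cosets of \<open>2 \<int>\<close>: among the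
  three differences of a triple of incongruent frequencies two would have the same pairing, and their
  difference could then only be an even integer (\<open>no_three_classes\<close>). On the other hand, since
  \<open>A\<close> has length \<open>1/2\<close>, the exponentials from a single coset account for at most half of
  the norm of a function supported in \<open>A\<close>. Completeness therefore needs two cosets, and needs both
  of them in full (\<open>spectrum_escapes_two_cosets\<close>).

  Hence three consecutive elements of one coset belong to \<open>\<Lambda>\<close>, together with an element of the
  other. Comparing the pairings of these three differences forces \<open>\<alpha>\<close> and
  \<open>\<beta> - 1\<close> to be nonzero even integers with the same power of two, possibly after exchanging
  \<open>B\<close> and \<open>C\<close> (\<open>tiling_offsets_if_three_consecutive\<close>). In that case
  \<open>{0, 1, \<alpha>, \<beta>}\<close> tiles the integers, the translations being the numbers with two
  prescribed binary digits equal to zero, and \<open>\<Omega>\<close> tiles the line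
  (\<open>tiling_offsets_imp_tiles\<close>).\<close>

section \<open>Best approximation by an orthonormal family\<close>

lemma integrable_mult_cnj:
  assumes "f \<in> L2_space M" and "g \<in> L2_space M"
  shows "integrable M (\<lambda>x. f x * cnj (g x))"
proof (rule Bochner_Integration.integrable_bound)
  show "integrable M (\<lambda>x. (cmod (f x))\<^sup>2 + (cmod (g x))\<^sup>2)"
    using assms by (simp add: L2_space_def)
  have [measurable]: "f \<in> borel_measurable M" "g \<in> borel_measurable M"
    using assms by (simp_all add: L2_space_def)
  have [measurable]: "cnj \<in> borel_measurable borel"
    by (intro borel_measurable_continuous_onI continuous_intros)
  show "(\<lambda>x. f x * cnj (g x)) \<in> borel_measurable M"
    by measurable
  show "AE x in M. norm (f x * cnj (g x)) \<le> norm ((cmod (f x))\<^sup>2 + (cmod (g x))\<^sup>2)"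
  proof (rule AE_I2)
    fix x
    have "2 * (cmod (f x) * cmod (g x)) \<le> (cmod (f x))\<^sup>2 + (cmod (g x))\<^sup>2"
      using sum_squares_bound[of "cmod (f x)" "cmod (g x)"] by (simp add: mult.assoc)
    moreover have "0 \<le> cmod (f x) * cmod (g x)" by simp
    ultimately show "norm (f x * cnj (g x)) \<le> norm ((cmod (f x))\<^sup>2 + (cmod (g x))\<^sup>2)"
      unfolding norm_mult complex_mod_cnj real_norm_def by linarith
  qed
qed

lemma L2_space_mult:
  assumes "f \<in> L2_space M"
  shows "(\<lambda>x. c * f x) \<in> L2_space M"
  using assms by (simp add: L2_space_def norm_mult power_mult_distrib borel_measurable_times)

lemma L2_space_diff:
  assumes "f \<in> L2_space M" and "g \<in> L2_space M"
  shows "(\<lambda>x. f x - g x) \<in> L2_space M"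
proof -
  have [measurable]: "f \<in> borel_measurable M" "g \<in> borel_measurable M"
    using assms by (simp_all add: L2_space_def)
  have "integrable M (\<lambda>x. (cmod (f x - g x))\<^sup>2)"
  proof (rule Bochner_Integration.integrable_bound)
    show "integrable M (\<lambda>x. 2 * (cmod (f x))\<^sup>2 + 2 * (cmod (g x))\<^sup>2)"
      using assms by (simp add: L2_space_def)
    show "(\<lambda>x. (cmod (f x - g x))\<^sup>2) \<in> borel_measurable M"
      by measurable
    show "AE x in M. norm ((cmod (f x - g x))\<^sup>2) \<le> norm (2 * (cmod (f x))\<^sup>2 + 2 * (cmod (g x))\<^sup>2)"
    proof (rule AE_I2)
      fix x
      have "(cmod (f x - g x))\<^sup>2 \<le> (cmod (f x) + cmod (g x))\<^sup>2"
        by (intro power_mono norm_triangle_ineq4) simp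
      also have "\<dots> \<le> 2 * (cmod (f x))\<^sup>2 + 2 * (cmod (g x))\<^sup>2"
        using sum_squares_bound[of "cmod (f x)" "cmod (g x)"] by (simp add: power2_sum)
      finally show "norm ((cmod (f x - g x))\<^sup>2) \<le> norm (2 * (cmod (f x))\<^sup>2 + 2 * (cmod (g x))\<^sup>2)"
        by simp
    qed
  qed
  then show ?thesis
    by (simp add: L2_space_def)
qed

lemma L2_space_sum:
  assumes "finite F" and "\<And>i. i \<in> F \<Longrightarrow> e i \<in> L2_space M"
  shows "(\<lambda>x. \<Sum>i\<in>F. c i * e i x) \<in> L2_space M"
  using assms
proof (induction F rule: finite_induct)
  case empty
  then show ?case by (simp add: L2_space_def)
next
  case (insert j F)
  have "(\<lambda>x. c j * e j x - (- 1) * (\<Sum>i\<in>F. c i * e i x)) \<in> L2_space M"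
    by (intro L2_space_diff L2_space_mult insert) (use insert in auto)
  with insert show ?case by simp
qed

lemma L2_inner_diff_mult_left:
  assumes "f \<in> L2_space M" "g \<in> L2_space M" "h \<in> L2_space M"
  shows "L2_inner M (\<lambda>x. f x - c * g x) h = L2_inner M f h - c * L2_inner M g h"
proof -
  have "L2_inner M (\<lambda>x. f x - c * g x) h
      = (LINT x|M. f x * cnj (h x) - c * (g x * cnj (h x)))"
    by (simp add: L2_inner_def algebra_simps)
  also have "\<dots> = L2_inner M f h - c * L2_inner M g h"
    using assms by (simp add: L2_inner_def integrable_mult_cnj)
  finally show ?thesis .
qed

lemma L2_inner_self:
  "L2_inner M f f = of_real (LINT x|M. (cmod (f x))\<^sup>2)"
  unfolding L2_inner_def
  by (simp only: complex_norm_square[symmetric] integral_complex_of_real)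

lemma L2_inner_commute: "L2_inner M g f = cnj (L2_inner M f g)"
  unfolding L2_inner_def
  by (simp flip: Bochner_Integration.integral_cnj add: mult.commute)

text \<open>Completing the square in the coefficient \<open>c\<close>.\<close>

lemma L2_norm_diff_unit:
  assumes h: "h \<in> L2_space M" and e: "e \<in> L2_space M" and unit: "L2_inner M e e = 1"
  shows "(LINT x|M. (cmod (h x - c * e x))\<^sup>2)
       = (LINT x|M. (cmod (h x))\<^sup>2) - (cmod (L2_inner M h e))\<^sup>2 + (cmod (L2_inner M h e - c))\<^sup>2"
proof -
  let ?g = "\<lambda>x. h x - c * e x" and ?p = "L2_inner M h e"
  have g: "?g \<in> L2_space M" using h e by (intro L2_space_diff L2_space_mult)
  have "L2_inner M ?g ?g = L2_inner M h ?g - c * L2_inner M e ?g"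
    using h e g by (rule L2_inner_diff_mult_left[of h M e])
  also have "L2_inner M h ?g = L2_inner M h h - cnj c * ?p"
    by (subst L2_inner_commute) (simp add: L2_inner_diff_mult_left h e flip: L2_inner_commute)
  also have "L2_inner M e ?g = cnj ?p - cnj c"
    by (subst L2_inner_commute) (simp add: L2_inner_diff_mult_left h e unit)
  finally have "L2_inner M ?g ?g = L2_inner M h h - cnj c * ?p - c * (cnj ?p - cnj c)" .
  also have "\<dots> = L2_inner M h h - ?p * cnj ?p + (?p - c) * cnj (?p - c)"
    by (simp add: algebra_simps)
  also have "\<dots> = of_real ((LINT x|M. (cmod (h x))\<^sup>2) - (cmod ?p)\<^sup>2 + (cmod (?p - c))\<^sup>2)"
    by (simp only: complex_norm_square[symmetric] L2_inner_self of_real_add of_real_diff)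
  finally show ?thesis
    unfolding L2_inner_self by (simp only: of_real_eq_iff)
qed

lemma L2_inner_diff_orthogonal_sum:
  assumes f: "f \<in> L2_space M" and h: "h \<in> L2_space M" and F: "finite F"
    and e: "\<And>i. i \<in> F \<Longrightarrow> e i \<in> L2_space M"
    and orth: "\<And>i. i \<in> F \<Longrightarrow> L2_inner M (e i) h = 0"
  shows "L2_inner M (\<lambda>x. f x - (\<Sum>i\<in>F. c i * e i x)) h = L2_inner M f h"
  using F e orth
proof (induction F rule: finite_induct)
  case empty
  then show ?case by simp
next
  case (insert k G)
  have "L2_inner M (\<lambda>x. (f x - (\<Sum>i\<in>G. c i * e i x)) - c k * e k x) h
      = L2_inner M (\<lambda>x. f x - (\<Sum>i\<in>G. c i * e i x)) h - c k * L2_inner M (e k) h"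
    using insert.hyps insert.prems(1)
    by (intro L2_inner_diff_mult_left L2_space_diff f h L2_space_sum) auto
  also have "\<dots> = L2_inner M f h"
    using insert.IH insert.prems by simp
  finally show ?case
    using insert.hyps by (simp add: diff_diff_eq add.commute)
qed

text \<open>The exact distance from \<open>f\<close> to an arbitrary combination of an orthonormal family. The optimal
  coefficients \<open>c\<close> give the inequality of Bessel, and arbitrary \<open>c\<close> show that an
  approximation with any coefficients already bounds the sum of the squared Fourier coefficients
  from below.\<close>

lemma L2_norm_diff_orthonormal_sum:
  assumes f: "f \<in> L2_space M" and F: "finite F" and e: "\<And>i. i \<in> F \<Longrightarrow> e i \<in> L2_space M"
    and on: "\<And>i j. i \<in> F \<Longrightarrow> j \<in> F \<Longrightarrow> L2_inner M (e i) (e j) = (if i = j then 1 else 0)"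
  shows "(LINT x|M. (cmod (f x - (\<Sum>i\<in>F. c i * e i x)))\<^sup>2)
       = (LINT x|M. (cmod (f x))\<^sup>2) - (\<Sum>i\<in>F. (cmod (L2_inner M f (e i)))\<^sup>2)
         + (\<Sum>i\<in>F. (cmod (L2_inner M f (e i) - c i))\<^sup>2)"
  using F e on
proof (induction F rule: finite_induct)
  case empty
  then show ?case by simp
next
  case (insert j F)
  let ?h = "\<lambda>x. f x - (\<Sum>i\<in>F. c i * e i x)"
  have inner: "L2_inner M ?h (e j) = L2_inner M f (e j)"
    using insert.hyps by (intro L2_inner_diff_orthogonal_sum f insert.prems) (auto simp: insert.prems)
  have h: "?h \<in> L2_space M"
    using insert.hyps by (intro L2_space_diff f L2_space_sum insert.prems) auto
  have "(LINT x|M. (cmod (?h x - c j * e j x))\<^sup>2)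
      = (LINT x|M. (cmod (?h x))\<^sup>2)
        - (cmod (L2_inner M f (e j)))\<^sup>2 + (cmod (L2_inner M f (e j) - c j))\<^sup>2"
    unfolding inner[symmetric]
    by (intro L2_norm_diff_unit h insert.prems) (simp_all add: insert.prems)
  moreover have "(LINT x|M. (cmod (?h x))\<^sup>2)
       = (LINT x|M. (cmod (f x))\<^sup>2) - (\<Sum>i\<in>F. (cmod (L2_inner M f (e i)))\<^sup>2)
         + (\<Sum>i\<in>F. (cmod (L2_inner M f (e i) - c i))\<^sup>2)"
    by (intro insert.IH insert.prems) auto
  ultimately show ?case
    using insert.hyps by (simp add: diff_diff_eq add.commute)
qed

lemma Bessel_inequality:
  assumes "f \<in> L2_space M" and "finite F" and "\<And>i. i \<in> F \<Longrightarrow> e i \<in> L2_space M"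
    and "\<And>i j. i \<in> F \<Longrightarrow> j \<in> F \<Longrightarrow> L2_inner M (e i) (e j) = (if i = j then 1 else 0)"
  shows "(\<Sum>i\<in>F. (cmod (L2_inner M f (e i)))\<^sup>2) \<le> (LINT x|M. (cmod (f x))\<^sup>2)"
proof -
  have "0 \<le> (LINT x|M. (cmod (f x - (\<Sum>i\<in>F. L2_inner M f (e i) * e i x)))\<^sup>2)"
    by (intro integral_nonneg_AE) simp
  also have "\<dots> = (LINT x|M. (cmod (f x))\<^sup>2) - (\<Sum>i\<in>F. (cmod (L2_inner M f (e i)))\<^sup>2)"
    by (subst L2_norm_diff_orthonormal_sum[OF assms]) simp_all
  finally show ?thesis by simp
qed

lemma orthonormal_basis_L2_Parseval:
  assumes basis: "orthonormal_basis_L2 M e I" and f: "f \<in> L2_space M" and eps: "0 < \<epsilon>"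
  obtains F where "finite F" "F \<subseteq> I"
    "(LINT x|M. (cmod (f x))\<^sup>2) - \<epsilon> < (\<Sum>i\<in>F. (cmod (L2_inner M f (e i)))\<^sup>2)"
proof -
  have "0 < sqrt \<epsilon>" using eps by simp
  with basis f obtain F c where F: "finite F" "F \<subseteq> I"
    and close: "L2_norm M (\<lambda>x. f x - (\<Sum>i\<in>F. c i * e i x)) < sqrt \<epsilon>"
    unfolding orthonormal_basis_L2_def by meson
  have "(LINT x|M. (cmod (f x))\<^sup>2) - (\<Sum>i\<in>F. (cmod (L2_inner M f (e i)))\<^sup>2)
      \<le> (LINT x|M. (cmod (f x - (\<Sum>i\<in>F. c i * e i x)))\<^sup>2)"
    using basis F unfolding orthonormal_basis_L2_def
    by (subst L2_norm_diff_orthonormal_sum[OF f]) (auto intro!: sum_nonneg simp: subset_iff)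
  also have "\<dots> < \<epsilon>"
    using close by (simp add: L2_norm_def)
  finally show thesis using that[OF F] by simp
qed

section \<open>Parity of the frequencies\<close>

definition odd_real :: "real \<Rightarrow> bool" where
  "odd_real r \<longleftrightarrow> (\<exists>k::int. odd k \<and> r = of_int k)"

definition even_real :: "real \<Rightarrow> bool" where
  "even_real r \<longleftrightarrow> (\<exists>k::int. even k \<and> r = of_int k)"

lemma odd_real_diff:
  assumes "odd_real r" "odd_real s"
  shows "even_real (r - s)"
proof -
  obtain j k :: int where "odd j" "r = of_int j" "odd k" "s = of_int k"
    using assms unfolding odd_real_def by auto
  then have "even (j - k) \<and> r - s = of_int (j - k)" by simp
  then show ?thesis unfolding even_real_def by blast
qed

lemma even_diff_odd_real:
  assumes "even_real r" "odd_real s"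
  shows "odd_real (r - s)"
proof -
  obtain j k :: int where "even j" "r = of_int j" "odd k" "s = of_int k"
    using assms unfolding odd_real_def even_real_def by auto
  then have "odd (j - k) \<and> r - s = of_int (j - k)" by simp
  then show ?thesis unfolding odd_real_def by blast
qed

lemma odd_real_imp_Ints: "odd_real r \<Longrightarrow> r \<in> \<int>"
  unfolding odd_real_def by auto

lemma not_even_odd_real: "even_real r \<Longrightarrow> \<not> odd_real r"
  unfolding odd_real_def even_real_def by auto

text \<open>With the left endpoints of \<open>A\<close>, \<open>B\<close>, \<open>C\<close> at
  \<open>0\<close>, \<open>\<alpha> / 4\<close>, \<open>\<beta> / 4\<close>, the Fourier transform of
  \<open>\<Omega>\<close> at the frequency \<open>2 * u\<close> is a multiple of a sum of four unit
  complex numbers, one for each quarter of \<open>\<Omega>\<close>. The predicate says that in this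
  sum \<open>B\<close> is opposite to the first half of \<open>A\<close>, and \<open>C\<close> to the
  second half.\<close>

definition cancels :: "real \<Rightarrow> real \<Rightarrow> real \<Rightarrow> bool" where
  "cancels \<alpha> \<beta> u \<longleftrightarrow> odd_real (u * \<alpha>) \<and> odd_real (u * (\<beta> - 1))"

lemma cancels_uminus: "cancels \<alpha> \<beta> (- u) \<longleftrightarrow> cancels \<alpha> \<beta> u"
proof -
  have odd_uminus: "odd_real (- r)" if "odd_real r" for r
    using even_diff_odd_real[of 0 r] that by (simp add: even_real_def)
  have "odd_real (- r) \<longleftrightarrow> odd_real r" for r
    using odd_uminus[of r] odd_uminus[of "- r"] by auto
  then show ?thesis by (simp add: cancels_def)
qed

text \<open>The numbers \<open>u\<close> with \<open>cancels \<alpha> \<beta> u\<close> behave like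
  odd numbers, so their differences are not among them. A difference \<open>d\<close> of two of them makes
  \<open>d * \<alpha>\<close> even, and if the roles of \<open>B\<close> and \<open>C\<close> are exchanged
  for \<open>d\<close>, then \<open>d * (\<alpha> - 1)\<close> is odd; subtracting the two leaves
  \<open>d\<close> itself.\<close>

lemma cancels_diff:
  assumes "cancels \<alpha> \<beta> u" "cancels \<alpha> \<beta> v"
  shows "\<not> cancels \<alpha> \<beta> (u - v)" and "cancels \<beta> \<alpha> (u - v) \<Longrightarrow> u - v \<in> \<int>"
proof -
  have ev: "even_real ((u - v) * \<alpha>)"
    using assms odd_real_diff unfolding cancels_def left_diff_distrib by blast
  then show "\<not> cancels \<alpha> \<beta> (u - v)"
    using not_even_odd_real unfolding cancels_def by blast
  assume "cancels \<beta> \<alpha> (u - v)"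
  then have "odd_real ((u - v) * \<alpha> - (u - v) * (\<alpha> - 1))"
    using even_diff_odd_real[OF ev] unfolding cancels_def by blast
  then show "u - v \<in> \<int>"
    by (simp add: algebra_simps odd_real_imp_Ints)
qed

text \<open>If \<open>u\<close>, \<open>v\<close>, \<open>u - v\<close> are the differences in a triple of
  frequencies, each is a zero of one of the two kinds. Two of the three are then of the same kind,
  and \<open>cancels_diff\<close> either contradicts the kind of the third or makes it an integer.\<close>

lemma no_three_classes:
  assumes u: "cancels \<alpha> \<beta> u \<or> cancels \<beta> \<alpha> u" and v: "cancels \<alpha> \<beta> v \<or> cancels \<beta> \<alpha> v"
    and uv: "cancels \<alpha> \<beta> (u - v) \<or> cancels \<beta> \<alpha> (u - v)"
  shows "u \<in> \<int> \<or> v \<in> \<int> \<or> u - v \<in> \<int>"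
proof -
  have vu: "cancels x y (v - u) \<longleftrightarrow> cancels x y (u - v)" for x y
    using cancels_uminus[of x y "u - v"] by simp
  have *: "u \<in> \<int> \<or> v \<in> \<int>"
    if "cancels x y u" "cancels y x v" "cancels x y (u - v) \<or> cancels y x (u - v)" for x y
    using that(3)
  proof
    assume "cancels x y (u - v)"
    with cancels_diff(2)[OF that(1) this] that(2) show ?thesis by simp
  next
    assume "cancels y x (u - v)"
    then have "cancels y x (v - u)" by (simp add: vu)
    with cancels_diff(2)[OF that(2) this] that(1) show ?thesis by simp
  qed
  show ?thesis
    using u v uv *[of \<alpha> \<beta>] *[of \<beta> \<alpha>] cancels_diff[of \<alpha> \<beta> u v] cancels_diff[of \<beta> \<alpha> u v] by blast
qed

text \<open>The condition under which \<open>{0, 1, \<alpha>, \<beta>}\<close> is a tile of the integers: the even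
  numbers \<open>\<alpha>\<close> and \<open>\<beta> - 1\<close> are nonzero and divisible by the
  same powers of two.\<close>

definition tiling_offsets :: "real \<Rightarrow> real \<Rightarrow> bool" where
  "tiling_offsets \<alpha> \<beta> \<longleftrightarrow>
     (\<exists>k p q. odd p \<and> odd q \<and> \<alpha> = of_int (2 * 2 ^ k * p) \<and> \<beta> = of_int (1 + 2 * 2 ^ k * q))"

text \<open>The ratio of \<open>\<alpha>\<close> and \<open>\<beta> - 1\<close> equals that of the odd
  numbers \<open>u * \<alpha>\<close> and \<open>u * (\<beta> - 1)\<close>, whence the equal powers
  of two.\<close>

lemma tiling_offsets_if_even:
  assumes u: "cancels \<alpha> \<beta> u" and \<alpha>: "even_real \<alpha>" and \<beta>: "even_real (\<beta> - 1)"
  shows "tiling_offsets \<alpha> \<beta>"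
proof -
  obtain a b :: int where a: "even a" "\<alpha> = a" and b: "even b" "\<beta> - 1 = b"
    using \<alpha> \<beta> unfolding even_real_def by auto
  obtain m n :: int where m: "odd m" "u * \<alpha> = m" and n: "odd n" "u * (\<beta> - 1) = n"
    using u unfolding cancels_def odd_real_def by auto
  have nz: "a \<noteq> 0" "b \<noteq> 0" using a b m n by auto
  have "real_of_int (a * n) = of_int (b * m)"
    unfolding of_int_mult a(2)[symmetric] b(2)[symmetric] m(2)[symmetric] n(2)[symmetric] by simp
  then have eq: "a * n = b * m" by (simp only: of_int_eq_iff)
  obtain p where p: "a = 2 ^ multiplicity 2 a * p" "odd p"
    using multiplicity_decompose'[of a 2] nz by auto
  obtain q where q: "b = 2 ^ multiplicity 2 b * q" "odd q"
    using multiplicity_decompose'[of b 2] nz by auto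
  have mult_odd: "multiplicity 2 (c * d) = multiplicity 2 c" if "c \<noteq> 0" "odd d" for c d :: int
  proof -
    have "d \<noteq> 0" using that(2) by auto
    then have "multiplicity 2 (c * d) = multiplicity 2 c + multiplicity 2 d"
      using that(1) by (intro prime_elem_multiplicity_mult_distrib) auto
    then show ?thesis using that(2) by (simp add: not_dvd_imp_multiplicity_0)
  qed
  from eq have mult: "multiplicity 2 a = multiplicity 2 b"
    using mult_odd[OF nz(1) n(1)] mult_odd[OF nz(2) m(1)] by simp
  have "multiplicity 2 a \<noteq> 0" using a(1) nz by (simp add: multiplicity_eq_zero_iff)
  then obtain k where k: "multiplicity 2 a = Suc k" by (cases "multiplicity 2 a") auto
  have "\<alpha> = of_int (2 * 2 ^ k * p)" using a p k by (metis power_Suc)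
  moreover have "\<beta> = of_int (1 + 2 * 2 ^ k * q)"
    using b(2) q(1) unfolding mult[symmetric] k by simp
  ultimately show ?thesis using p q unfolding tiling_offsets_def by blast
qed

lemma tiling_offsets_if_consecutive:
  assumes "cancels \<alpha> \<beta> u" "cancels \<alpha> \<beta> (u + 1)"
  shows "tiling_offsets \<alpha> \<beta>"
proof (rule tiling_offsets_if_even[OF assms(1)])
  show "even_real \<alpha>" 
    using odd_real_diff[of "(u + 1) * \<alpha>" "u * \<alpha>"] assms by (simp add: cancels_def algebra_simps)
  show "even_real (\<beta> - 1)" 
    using odd_real_diff[of "(u + 1) * (\<beta> - 1)" "u * (\<beta> - 1)"] assms by (simp add: cancels_def algebra_simps)
qed

text \<open>The first two hypotheses make \<open>\<alpha>\<close> and \<open>\<beta> - 1\<close> integers, of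
  equal parity because their ratio is a ratio of odd numbers. If both are odd, then
  \<open>\<beta>\<close> and \<open>\<alpha> - 1\<close> are even, and the zero
  \<open>v\<close> of the other kind takes over with \<open>B\<close> and \<open>C\<close> exchanged.\<close>

lemma tiling_offsets_if_alternating:
  assumes u: "cancels \<alpha> \<beta> u" and u2: "cancels \<alpha> \<beta> (u + 2)" and v: "cancels \<beta> \<alpha> v"
  shows "tiling_offsets \<alpha> \<beta> \<or> tiling_offsets \<beta> \<alpha>"
proof -
  have half: "\<exists>k::int. r = k" if "even_real (2 * r)" for r
  proof -
    from that obtain k :: int where "2 * r = 2 * of_int k"
      unfolding even_real_def by (auto elim!: evenE)
    then show ?thesis by auto
  qed
  have "even_real (2 * \<alpha>)" 
    using odd_real_diff[of "(u + 2) * \<alpha>" "u * \<alpha>"] u u2 by (simp add: cancels_def algebra_simps)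
  then obtain a :: int where a: "\<alpha> = a" using half by blast
  have "even_real (2 * (\<beta> - 1))" 
    using odd_real_diff[of "(u + 2) * (\<beta> - 1)" "u * (\<beta> - 1)"] u u2 by (simp add: cancels_def algebra_simps)
  then obtain b :: int where b: "\<beta> - 1 = b" using half by blast
  obtain m n :: int where m: "odd m" "u * \<alpha> = m" and n: "odd n" "u * (\<beta> - 1) = n"
    using u unfolding cancels_def odd_real_def by auto
  have "real_of_int (a * n) = of_int (b * m)"
    unfolding of_int_mult a[symmetric] b[symmetric] m(2)[symmetric] n(2)[symmetric] by simp
  then have "a * n = b * m" by (simp only: of_int_eq_iff)
  then have parity: "even a \<longleftrightarrow> even b" using m n by (metis even_mult_iff)
  show ?thesis
  proof (cases "even a")
    case True
    then have "tiling_offsets \<alpha> \<beta>"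
      using tiling_offsets_if_even[OF u] a b parity unfolding even_real_def by blast
    then show ?thesis ..
  next
    case False
    have "\<beta> = of_int (b + 1)" "\<alpha> - 1 = of_int (a - 1)" using a b by auto
    moreover have "even (b + 1)" "even (a - 1)" using False parity by auto
    ultimately have "even_real \<beta>" "even_real (\<alpha> - 1)" unfolding even_real_def by blast+
    then have "tiling_offsets \<beta> \<alpha>" by (rule tiling_offsets_if_even[OF v])
    then show ?thesis ..
  qed
qed

text \<open>Among three consecutive zeros either two neighbours are of the same kind or the kinds
  alternate.\<close>

lemma tiling_offsets_if_three_consecutive:
  assumes "\<And>k. k \<in> {0, 1, 2} \<Longrightarrow> cancels \<alpha> \<beta> (u + k) \<or> cancels \<beta> \<alpha> (u + k)"
  shows "tiling_offsets \<alpha> \<beta> \<or> tiling_offsets \<beta> \<alpha>"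
proof -
  have two: "u + 1 + 1 = u + 2" by simp
  show ?thesis
    using assms[of 0] assms[of 1] assms[of 2]
      tiling_offsets_if_consecutive[of \<alpha> \<beta> u] tiling_offsets_if_consecutive[of \<alpha> \<beta> "u + 1"]
      tiling_offsets_if_consecutive[of \<beta> \<alpha> u] tiling_offsets_if_consecutive[of \<beta> \<alpha> "u + 1"]
      tiling_offsets_if_alternating[of \<alpha> \<beta> u "u + 1"] tiling_offsets_if_alternating[of \<beta> \<alpha> u "u + 1"]
    unfolding two by simp blast
qed

section \<open>Characters on intervals\<close>

definition character :: "real \<Rightarrow> real \<Rightarrow> complex" where
  "character l x = exp (2 * of_real pi * \<i> * of_real l * of_real x)"

lemma norm_character [simp]: "cmod (character l x) = 1"
proof -
  have "character l x = exp (\<i> * of_real (2 * pi * l * x))"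
    by (simp add: character_def mult_ac)
  then show ?thesis by (simp only: norm_exp_i_times)
qed

lemma character_0 [simp]: "character 0 x = 1"
  by (simp add: character_def)

lemma character_add: "character l (x + y) = character l x * character l y"
  by (simp add: character_def exp_add distrib_left)

lemma cnj_character: "cnj (character l x) = character (- l) x"
  by (simp add: character_def exp_cnj)

lemma character_mult_cnj: "character l x * cnj (character m x) = character (l - m) x"
  by (simp add: cnj_character) (simp add: character_def exp_add[symmetric] algebra_simps)

lemma continuous_on_character: "continuous_on S (character l)"
  unfolding character_def by (intro continuous_intros)

lemma character_eq_1_iff: "character l x = 1 \<longleftrightarrow> l * x \<in> \<int>"
proof
  assume "character l x = 1"
  then obtain n :: int where "2 * pi * l * x = of_int (2 * n) * pi"
    unfolding character_def exp_eq_1 by auto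
  then have "l * x = of_int n" by simp
  then show "l * x \<in> \<int>" by simp
next
  assume "l * x \<in> \<int>"
  then obtain n :: int where "l * x = of_int n" by (auto elim: Ints_cases)
  then show "character l x = 1"
    unfolding character_def exp_eq_1 by (auto simp: mult.assoc)
qed

lemma character_eq_minus_1_imp:
  assumes "character l x = - 1"
  shows "odd_real (2 * l * x)"
proof -
  have "character (2 * l) x = 1"
  proof -
    have "character (2 * l) x = character l x * character l x"
      by (simp add: character_def exp_add[symmetric] algebra_simps)
    with assms show ?thesis by simp
  qed
  then obtain n :: int where n: "2 * l * x = of_int n"
    unfolding character_eq_1_iff by (auto elim: Ints_cases)
  have "odd n"
  proof
    assume "even n"
    then obtain k where "n = 2 * k" by (elim evenE)
    with n have "l * x = of_int k" by simp
    then have "character l x = 1" unfolding character_eq_1_iff by simp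
    with assms show False by simp
  qed
  with n show ?thesis unfolding odd_real_def by blast
qed

text \<open>An interval with left endpoint \<open>a\<close> and length \<open>h\<close>, where each endpoint may
  or may not belong to it.\<close>

definition interval_from :: "real \<Rightarrow> real \<Rightarrow> real set \<Rightarrow> bool" where
  "interval_from a h I \<longleftrightarrow> {a<..<a + h} \<subseteq> I \<and> I \<subseteq> {a..a + h}"

lemma interval_from_exists:
  assumes "is_interval I" and "measure lebesgue I = h" and "0 < h"
  obtains a where "interval_from a h I"
proof -
  \<comment> \<open>The function \<open>measure\<close> takes the value \<open>0\<close> on sets of infinite measure.\<close>
  have unbounded: "measure lebesgue S = 0" if wide: "\<And>n::nat. \<exists>a. {a<..<a + real n} \<subseteq> S" for S :: "real set"
  proof (rule ccontr)
    assume m: "measure lebesgue S \<noteq> 0"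
    then have S: "S \<in> sets lebesgue" using measure_notin_sets by blast
    have fin: "emeasure lebesgue S \<noteq> \<infinity>" using m by (auto simp: measure_def)
    obtain n :: nat where n: "measure lebesgue S < real n" using reals_Archimedean2 by blast
    obtain a where "{a<..<a + real n} \<subseteq> S" using wide by blast
    then have "measure lebesgue {a<..<a + real n} \<le> measure lebesgue S"
      using S fin by (intro measure_mono_fmeasurable) (auto simp: fmeasurable_def top.not_eq_extremum)
    with n show False by simp
  qed
  obtain a b where ab: "I = {} \<or> I = UNIV \<or> I = {..<b} \<or> I = {..b} \<or> I = {a<..} \<or> I = {a..} \<or>
    I = {a<..<b} \<or> I = {a<..b} \<or> I = {a..<b} \<or> I = {a..b}"
    using is_real_interval[OF assms(1)] by blast
  have left: "\<exists>c. {c<..<c + real n} \<subseteq> {..<b}" for n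
    by (rule exI[of _ "b - real n"]) auto
  have right: "\<exists>c. {c<..<c + real n} \<subseteq> {a<..}" for n
    by (rule exI[of _ a]) auto
  have "measure lebesgue S = 0" if "{..<b} \<subseteq> S \<or> {a<..} \<subseteq> S" for S
    using that left right by (intro unbounded) (meson subset_trans)
  moreover have "{..<b} \<subseteq> {..b}" "{a<..} \<subseteq> {a..}" by auto
  moreover have "I \<noteq> {}" using assms(2,3) by auto
  moreover have "measure lebesgue I \<noteq> 0" using assms(2,3) by simp
  ultimately have "I = {a<..<b} \<or> I = {a<..b} \<or> I = {a..<b} \<or> I = {a..b}"
    using ab by blast
  moreover from this have "a < b"
    using assms(2,3) by (cases "a < b") (auto split: if_splits)
  ultimately have "b = a + h \<and> {a<..<b} \<subseteq> I \<and> I \<subseteq> {a..b}"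
    using assms(2) by auto
  then show thesis using that[of a] unfolding interval_from_def by blast
qed

context
  fixes a h :: real and I :: "real set"
  assumes I: "interval_from a h I"
begin

lemma has_integral_interval_from_iff:
  fixes f :: "real \<Rightarrow> complex"
  shows "(f has_integral y) I \<longleftrightarrow> (f has_integral y) {a..a + h}"
proof (rule has_integral_spike_set_eq)
  have "{x \<in> I - {a..a + h}. f x \<noteq> 0} \<subseteq> {}" "{x \<in> {a..a + h} - I. f x \<noteq> 0} \<subseteq> {a, a + h}"
    using I unfolding interval_from_def by force+
  then show "negligible {x \<in> I - {a..a + h}. f x \<noteq> 0}" "negligible {x \<in> {a..a + h} - I. f x \<noteq> 0}"
    by (meson finite.emptyI finite_insert negligible_finite negligible_subset)+
qed

lemma lmeasurable_interval_from: "I \<in> lmeasurable"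
proof -
  have "I - {a<..<a + h} \<subseteq> {a, a + h}"
    using I unfolding interval_from_def by force
  then have "negligible (I - {a<..<a + h})"
    by (meson finite.emptyI finite_insert negligible_finite negligible_subset)
  then have "I - {a<..<a + h} \<in> lmeasurable" by (rule negligible_imp_measurable)
  then have "{a<..<a + h} \<union> (I - {a<..<a + h}) \<in> lmeasurable"
    by (intro fmeasurable.Un) auto
  moreover have "{a<..<a + h} \<union> (I - {a<..<a + h}) = I"
    using I unfolding interval_from_def by blast
  ultimately show ?thesis by simp
qed

lemma has_integral_character:
  assumes h: "0 \<le> h" and l: "l \<noteq> 0"
  shows "(character l has_integral
           character l a * (character l h - 1) / (2 * of_real pi * \<i> * of_real l)) I"
proof -
  let ?w = "2 * of_real pi * \<i> * of_real l :: complex"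
  have w: "?w \<noteq> 0" using l by simp
  have "((\<lambda>x. exp (?w * of_real x)) has_integral
      exp (?w * of_real (a + h)) / ?w - exp (?w * of_real a) / ?w) {a..a + h}"
  proof (rule fundamental_theorem_of_calculus)
    show "a \<le> a + h" using h by simp
  next
    fix x assume "x \<in> {a..a + h}"
    have "((\<lambda>z. exp (?w * z) / ?w) has_field_derivative exp (?w * of_real x)) (at (of_real x))"
      by (rule derivative_eq_intros refl | use w in simp)+
    then show "((\<lambda>x. exp (?w * of_real x) / ?w) has_vector_derivative exp (?w * of_real x))
        (at x within {a..a + h})"
      by (rule has_vector_derivative_real_field)
  qed
  then have "((\<lambda>x. exp (?w * of_real x)) has_integral
      exp (?w * of_real (a + h)) / ?w - exp (?w * of_real a) / ?w) I"
    by (simp only: has_integral_interval_from_iff)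
  moreover have "exp (?w * of_real (a + h)) / ?w - exp (?w * of_real a) / ?w
      = character l a * (character l h - 1) / ?w"
    by (simp add: character_def exp_add distrib_left diff_divide_distrib right_diff_distrib)
  ultimately show ?thesis
    unfolding character_def by simp
qed

end

lemma bounded_L2_space:
  assumes S: "S \<in> lmeasurable" and "f \<in> borel_measurable (lebesgue_on S)" and B: "\<And>x. cmod (f x) \<le> B"
  shows "f \<in> L2_space (lebesgue_on S)"
proof -
  interpret finite_measure "lebesgue_on S" using S by (rule finite_measure_lebesgue_on)
  have [measurable]: "f \<in> borel_measurable (lebesgue_on S)" by fact
  have "norm ((cmod (f x))\<^sup>2) \<le> B\<^sup>2" for x
    using power_mono[OF B, of x 2] by simp
  then have "integrable (lebesgue_on S) (\<lambda>x. (cmod (f x))\<^sup>2)"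
    by (intro integrable_const_bound[where B = "B\<^sup>2"]) auto
  then show ?thesis by (simp add: L2_space_def)
qed

lemma measurable_character:
  "S \<in> sets lebesgue \<Longrightarrow> character l \<in> borel_measurable (lebesgue_on S)"
  by (intro continuous_imp_measurable_on_sets_lebesgue continuous_on_character)

lemma character_L2_space: "S \<in> lmeasurable \<Longrightarrow> character l \<in> L2_space (lebesgue_on S)"
  by (rule bounded_L2_space[where B = 1]) (auto intro: measurable_character)

lemma lebesgue_integral_character:
  assumes S: "S \<in> lmeasurable"
  shows "integral\<^sup>L (lebesgue_on S) (character l) = integral S (character l)"
proof -
  interpret finite_measure "lebesgue_on S" using S by (rule finite_measure_lebesgue_on)
  have "integrable (lebesgue_on S) (character l)"
    by (intro integrable_const_bound[where B = 1] measurable_character) (use S in auto)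
  then show ?thesis
    using S by (intro lebesgue_integral_eq_integral) auto
qed

lemma L2_inner_character:
  assumes "S \<in> lmeasurable"
  shows "L2_inner (lebesgue_on S) (character l) (character m) = integral S (character (l - m))"
  using lebesgue_integral_character[OF assms] by (simp add: L2_inner_def character_mult_cnj)

section \<open>The zeros of the Fourier transform\<close>

text \<open>Four unit vectors with sum zero form two opposite pairs. The conjugates, which are the inverses, also
  have sum zero; so \<open>e\<^sub>2 = - e\<^sub>3\<close> and \<open>e\<^sub>1 = - 1\<close>
  for the elementary symmetric functions of \<open>x\<close>, \<open>y\<close>, \<open>z\<close>,
  and the product of \<open>1 + x\<close>, \<open>1 + y\<close>, \<open>1 + z\<close> vanishes.\<close>

lemma four_unit_numbers_sum_zero:
  fixes x y z :: complex
  assumes "1 + x + y + z = 0" and "cmod x = 1" "cmod y = 1" "cmod z = 1"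
  shows "x = - 1 \<or> y = - 1 \<or> z = - 1"
proof -
  have c: "x * cnj x = 1" "y * cnj y = 1" "z * cnj z = 1"
    using assms(2-4) by (simp_all flip: complex_norm_square)
  have "1 + cnj x + cnj y + cnj z = 0"
    using arg_cong[OF assms(1), of cnj] by simp
  then have "0 = x * y * z * (1 + cnj x + cnj y + cnj z)" by simp
  also have "\<dots> = x * y * z + (x * cnj x) * y * z + (y * cnj y) * x * z + (z * cnj z) * x * y"
    by (simp add: algebra_simps)
  finally have "x * y * z + y * z + x * z + x * y = 0" unfolding c by simp
  then have "(1 + x) * (1 + y) * (1 + z) = 0"
    using assms(1) by (simp add: algebra_simps)
  then show ?thesis by (auto simp: add_eq_0_iff)
qed

text \<open>Up to nonzero factors the integral is \<open>(z - 1) * (1 + z + w b + w c)\<close>, where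
  \<open>z\<close> is the phase over a quarter and \<open>w b\<close>, \<open>w c\<close> are the phases
  of the offsets of \<open>B\<close> and \<open>C\<close>. The hypothesis on \<open>l\<close>
  excludes \<open>z = 1\<close> and \<open>z = - 1\<close>, so that the second half of \<open>A\<close> is
  opposite to \<open>B\<close> or to \<open>C\<close>, not to the first half.\<close>

lemma integral_character_eq_0_imp_cancels:
  assumes A: "interval_from a (1/2) A" and B: "interval_from b (1/4) B" and C: "interval_from c (1/4) C"
    and disj: "A \<inter> B = {}" "A \<inter> C = {}" "B \<inter> C = {}"
    and zero: "integral (A \<union> B \<union> C) (character l) = 0" and l: "l / 2 \<notin> \<int>"
  shows "cancels (4 * (b - a)) (4 * (c - a)) (l / 2) \<or> cancels (4 * (c - a)) (4 * (b - a)) (l / 2)"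
proof -
  define z where "z = character l (1/4)"
  define w where "w t = character l (t - a)" for t
  have l0: "l \<noteq> 0" using l by auto
  let ?d = "2 * of_real pi * \<i> * of_real l :: complex"
  have "(character l has_integral (character l a * (character l (1/2) - 1) / ?d
      + character l b * (character l (1/4) - 1) / ?d) + character l c * (character l (1/4) - 1) / ?d)
      (A \<union> B \<union> C)"
    using A B C l0 disj
    by (intro has_integral_Un has_integral_character) (auto simp: Int_Un_distrib2)
  then have "(character l a * (character l (1/2) - 1) / ?d
      + character l b * (character l (1/4) - 1) / ?d) + character l c * (character l (1/4) - 1) / ?d = 0"
    using zero integral_unique by metis
  then have sum_l: "character l a * (character l (1/2) - 1)
      + character l b * (character l (1/4) - 1) + character l c * (character l (1/4) - 1) = 0"
    using l0 by (simp flip: add_divide_distrib)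
  have half: "character l (1/2) = z * z"
    using character_add[of l "1/4" "1/4"] by (simp add: z_def)
  have shift: "character l t = character l a * w t" for t
    using character_add[of l a "t - a"] by (simp add: w_def)
  have "character l a * ((z - 1) * (1 + z + w b + w c)) = 0"
    using sum_l unfolding half shift[of b] shift[of c] z_def[symmetric] by (simp add: algebra_simps)
  moreover have "character l a \<noteq> 0" using norm_character[of l a] by (metis norm_zero zero_neq_one)
  moreover have "z \<noteq> 1"
  proof
    assume "z = 1"
    then have "l * (1/4) \<in> \<int>" unfolding z_def character_eq_1_iff .
    from Ints_add[OF this this] have "l / 2 \<in> \<int>" by simp
    with l show False by simp
  qed
  ultimately have sum: "1 + z + w b + w c = 0" by simp
  have z1: "z \<noteq> - 1"
  proof
    assume "z = - 1"
    then have "odd_real (2 * l * (1/4))" unfolding z_def by (rule character_eq_minus_1_imp)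
    with l show False by (auto dest: odd_real_imp_Ints)
  qed
  have *: "cancels (4 * (s - a)) (4 * (t - a)) (l / 2)" if "w s = - 1" "w t = - z" for s t
  proof -
    have "odd_real (2 * l * (s - a))"
      using that(1) unfolding w_def by (rule character_eq_minus_1_imp)
    moreover have "character l (t - a - 1/4) = - 1"
    proof -
      have "z * character l (t - a - 1/4) = w t"
        using character_add[of l "1/4" "t - a - 1/4"] by (simp add: z_def w_def)
      moreover have "z \<noteq> 0" using norm_character[of l "1/4"] unfolding z_def by (metis norm_zero zero_neq_one)
      ultimately show ?thesis using that(2) by (metis mult_cancel_left mult_minus1_right)
    qed
    then have "odd_real (2 * l * (t - a - 1/4))" by (rule character_eq_minus_1_imp)
    ultimately show ?thesis by (simp add: cancels_def algebra_simps)
  qed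
  have "w b = - 1 \<or> w c = - 1"
    using four_unit_numbers_sum_zero[OF sum] z1 by (simp add: z_def w_def)
  then show ?thesis
  proof
    assume "w b = - 1"
    moreover from this sum have "w c = - z" by (simp add: add_eq_0_iff)
    ultimately show ?thesis using *[of b c] by blast
  next
    assume "w c = - 1"
    moreover from this sum have "w b = - z" by (simp add: add_eq_0_iff)
    ultimately show ?thesis using *[of c b] by blast
  qed
qed

section \<open>Completeness forces two full cosets\<close>

lemma integral_character_half_interval:
  assumes A: "interval_from a (1/2) A" and l: "l / 2 \<in> \<int>"
  shows "integral A (character l) = (if l = 0 then 1/2 else 0)"
proof (cases "l = 0")
  case True
  have "integral A (\<lambda>x. 1 :: complex) = integral {a..a + 1/2} (\<lambda>x. 1)"
    unfolding integral_def integrable_on_def has_integral_interval_from_iff[OF A] ..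
  moreover have "character 0 = (\<lambda>x. 1)" by (rule ext) simp
  ultimately show ?thesis using True by (simp add: scaleR_conv_of_real)
next
  case False
  have "character l (1/2) = 1" using l by (simp add: character_eq_1_iff)
  then show ?thesis
    using integral_unique[OF has_integral_character[OF A _ False]] False by simp
qed

text \<open>After scaling by \<open>sqrt 2\<close> the characters from one coset of \<open>2 \<int>\<close> are
  orthonormal on \<open>A\<close>, because \<open>A\<close> has length \<open>1/2\<close>. Hence those
  of unit norm on \<open>\<Omega>\<close> carry at most half of the squared norm \<open>1/2\<close> of a
  character on \<open>A\<close>.\<close>

lemma exponentials_of_coset_le_half:
  assumes A: "interval_from a (1/2) A" and F: "finite F" and coset: "\<And>l. l \<in> F \<Longrightarrow> (l - y) / 2 \<in> \<int>"
  shows "(\<Sum>l\<in>F. (cmod (integral A (character (z - l))))\<^sup>2) \<le> 1/4"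
proof -
  have Am: "A \<in> lmeasurable" using lmeasurable_interval_from[OF A] by simp
  define e where "e l x = of_real (sqrt 2) * character l x" for l x
  have inner: "L2_inner (lebesgue_on A) f (e l) = of_real (sqrt 2) * L2_inner (lebesgue_on A) f (character l)" for f l
  proof -
    have "f x * cnj (e l x) = of_real (sqrt 2) * (f x * cnj (character l x))" for x
      by (simp add: e_def)
    then show ?thesis by (simp only: L2_inner_def integral_mult_right_zero)
  qed
  have on: "L2_inner (lebesgue_on A) (e l) (e m) = (if l = m then 1 else 0)" if "l \<in> F" "m \<in> F" for l m
  proof -
    have "(l - y) / 2 - (m - y) / 2 \<in> \<int>" using that coset by (intro Ints_diff)
    then have int: "(l - m) / 2 \<in> \<int>" by (simp add: diff_divide_distrib)
    have "L2_inner (lebesgue_on A) (e l) (e m) = of_real (sqrt 2) * L2_inner (lebesgue_on A) (e l) (character m)"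
      by (rule inner)
    also have "L2_inner (lebesgue_on A) (e l) (character m)
        = of_real (sqrt 2) * L2_inner (lebesgue_on A) (character l) (character m)"
      by (simp add: L2_inner_def e_def mult.assoc)
    also have "L2_inner (lebesgue_on A) (character l) (character m) = (if l = m then 1/2 else 0)"
      unfolding L2_inner_character[OF Am] integral_character_half_interval[OF A int] by simp
    finally show ?thesis by (simp flip: of_real_mult mult.assoc)
  qed
  have "e l \<in> L2_space (lebesgue_on A)" for l
    unfolding e_def[abs_def] by (intro L2_space_mult character_L2_space Am)
  then have "(\<Sum>l\<in>F. (cmod (L2_inner (lebesgue_on A) (character z) (e l)))\<^sup>2)
      \<le> (LINT x|lebesgue_on A. (cmod (character z x))\<^sup>2)"
    by (intro Bessel_inequality character_L2_space Am F on)
  also have "(LINT x|lebesgue_on A. (cmod (character z x))\<^sup>2) = 1/2"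
  proof -
    have "L2_inner (lebesgue_on A) (character z) (character z) = complex_of_real (1/2)"
      using integral_character_half_interval[OF A, of 0] L2_inner_character[OF Am, of z z] by simp
    then show ?thesis unfolding L2_inner_self by (simp only: of_real_eq_iff)
  qed
  finally have "(\<Sum>l\<in>F. 2 * (cmod (integral A (character (z - l))))\<^sup>2) \<le> 1/2"
    by (simp add: inner L2_inner_character[OF Am] norm_mult power_mult_distrib)
  then show ?thesis by (simp flip: sum_distrib_left)
qed

text \<open>Test completeness on the character with frequency \<open>z\<close>, cut off outside \<open>A\<close>. If the
  spectrum were covered by the two cosets, the frequencies congruent to \<open>z\<close> would
  contribute nothing, being orthogonal on \<open>A\<close> and different from \<open>z\<close>, and those of
  the other coset only half of what is required.\<close>

lemma spectrum_escapes_two_cosets: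
  assumes A: "interval_from a (1/2) A" and sub: "A \<subseteq> \<Omega>" and \<Omega>: "\<Omega> \<in> lmeasurable" "measure lebesgue \<Omega> = 1"
    and basis: "orthonormal_basis_L2 (lebesgue_on \<Omega>) (exponential_on \<Omega>) \<Lambda>" and z: "z \<notin> \<Lambda>"
  shows "\<exists>l\<in>\<Lambda>. (l - z) / 2 \<notin> \<int> \<and> (l - y) / 2 \<notin> \<int>"
proof (rule ccontr)
  assume "\<not> ?thesis"
  then have cover: "(l - z) / 2 \<in> \<int> \<or> (l - y) / 2 \<in> \<int>" if "l \<in> \<Lambda>" for l
    using that by blast
  have Am: "A \<in> lmeasurable" using lmeasurable_interval_from[OF A] by simp
  define f where "f x = (if x \<in> A then character z x else 0)" for x
  have inner: "L2_inner (lebesgue_on \<Omega>) f (exponential_on \<Omega> l) = integral A (character (z - l))" for l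
  proof -
    have "L2_inner (lebesgue_on \<Omega>) f (exponential_on \<Omega> l)
        = (LINT x|lebesgue_on \<Omega>. (if x \<in> A then character (z - l) x else 0))"
      unfolding L2_inner_def character_mult_cnj[symmetric]
      using sub by (intro Bochner_Integration.integral_cong) 
        (auto simp: f_def exponential_on_def \<Omega> character_def)
    also have "\<dots> = (LINT x|lebesgue_on (A \<inter> \<Omega>). character (z - l) x)"
      using Am \<Omega> by (intro Lebesgue_Measure.integral_restrict_Int) auto
    also have "A \<inter> \<Omega> = A" using sub by blast
    finally show ?thesis using lebesgue_integral_character[OF Am] by simp
  qed
  have "f \<in> borel_measurable (lebesgue_on \<Omega>)"
  proof -
    have "A \<in> sets (lebesgue_on \<Omega>)"
      using sub Am \<Omega> by (auto simp: sets_restrict_space)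
    moreover have "character z \<in> borel_measurable (lebesgue_on \<Omega>)"
      using \<Omega> by (intro measurable_character) auto
    ultimately show ?thesis unfolding f_def[abs_def] by measurable
  qed
  then have f: "f \<in> L2_space (lebesgue_on \<Omega>)"
    using \<Omega> by (intro bounded_L2_space[where B = 1]) (auto simp: f_def)
  have "(LINT x|lebesgue_on \<Omega>. (cmod (f x))\<^sup>2) = (LINT x|lebesgue_on \<Omega>. (if x \<in> A then 1 else 0))"
    by (intro Bochner_Integration.integral_cong) (auto simp: f_def)
  also have "\<dots> = (LINT x|lebesgue_on (A \<inter> \<Omega>). 1)"
    using Am \<Omega> by (intro Lebesgue_Measure.integral_restrict_Int) auto
  also have "A \<inter> \<Omega> = A" using sub by blast
  also have "(LINT x|lebesgue_on A. (1::real)) = 1/2"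
  proof -
    have one: "character 0 = (\<lambda>x. 1)" by (rule ext) simp
    have "complex_of_real (LINT x|lebesgue_on A. 1) = integral\<^sup>L (lebesgue_on A) (character 0)"
      unfolding one by (simp only: integral_complex_of_real[symmetric] of_real_1)
    also have "\<dots> = integral A (character 0)" by (rule lebesgue_integral_character[OF Am])
    also have "\<dots> = complex_of_real (1/2)"
      using integral_character_half_interval[OF A, of 0] by simp
    finally show ?thesis by (simp only: of_real_eq_iff)
  qed
  finally have normf: "(LINT x|lebesgue_on \<Omega>. (cmod (f x))\<^sup>2) = 1/2" .
  obtain F where F: "finite F" "F \<subseteq> \<Lambda>"
    and big: "1/2 - 1/4 < (\<Sum>l\<in>F. (cmod (L2_inner (lebesgue_on \<Omega>) f (exponential_on \<Omega> l)))\<^sup>2)"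
    using orthonormal_basis_L2_Parseval[OF basis f, of "1/4"] unfolding normf by auto
  \<comment> \<open>The remaining frequencies are congruent to \<open>z\<close> and orthogonal to it on \<open>A\<close>.\<close>
  define G where "G = {l \<in> F. (l - y) / 2 \<in> \<int>}"
  have "(\<Sum>l\<in>F. (cmod (integral A (character (z - l))))\<^sup>2) = (\<Sum>l\<in>G. (cmod (integral A (character (z - l))))\<^sup>2)"
  proof (rule sum.mono_neutral_right)
    show "\<forall>l\<in>F - G. (cmod (integral A (character (z - l))))\<^sup>2 = 0"
    proof
      fix l assume l: "l \<in> F - G"
      then have "(l - z) / 2 \<in> \<int>" using cover F unfolding G_def by blast
      then have "- ((l - z) / 2) \<in> \<int>" by (rule Ints_minus)
      then have "(z - l) / 2 \<in> \<int>" by (simp add: diff_divide_distrib)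
      moreover have "z \<noteq> l" using l z F by blast
      ultimately show "(cmod (integral A (character (z - l))))\<^sup>2 = 0"
        using integral_character_half_interval[OF A, of "z - l"] by simp
    qed
  qed (auto simp: G_def F)
  also have "\<dots> \<le> 1/4"
    using F by (intro exponentials_of_coset_le_half[OF A, where y = y]) (auto simp: G_def)
  finally show False using big by (simp add: inner)
qed

section \<open>Tiling the integers and the line\<close>

text \<open>The numbers whose binary digits at the positions \<open>0\<close> and \<open>Suc k\<close> vanish. Adding
  \<open>1\<close> to such a number sets the lowest digit, and adding an odd multiple of
  \<open>2 ^ Suc k\<close> sets the other.\<close>

definition translation_set :: "nat \<Rightarrow> int set" where
  "translation_set k = {t. even t \<and> even (t div 2 ^ Suc k)}"

lemma translation_set_unique_offset:
  assumes "odd p" and "odd q"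
  shows "\<exists>!d. d \<in> {0, 1, 2 * 2 ^ k * p, 1 + 2 * 2 ^ k * q} \<and> m - d \<in> translation_set k"
proof -
  \<comment> \<open>Subtracting an odd multiple of \<open>2 ^ Suc k\<close> flips the digit at position \<open>Suc k\<close>.\<close>
  have shift: "n - 2 * 2 ^ k * r \<in> translation_set k \<longleftrightarrow> even n \<and> odd (n div 2 ^ Suc k)" if "odd r" for n r :: int
  proof -
    have "n - 2 * 2 ^ k * r = n + (- r) * 2 ^ Suc k" by simp
    then have "(n - 2 * 2 ^ k * r) div 2 ^ Suc k = n div 2 ^ Suc k - r"
      using div_mult_self1[of "2 ^ Suc k" n "- r"] by (simp add: mult.commute mult.left_commute)
    with that show ?thesis unfolding translation_set_def by simp
  qed
  have q: "m - (1 + 2 * 2 ^ k * q) = (m - 1) - 2 * 2 ^ k * q" by simp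
  have "m - 0 \<in> translation_set k \<longleftrightarrow> even m \<and> even (m div 2 ^ Suc k)"
    "m - 1 \<in> translation_set k \<longleftrightarrow> odd m \<and> even ((m - 1) div 2 ^ Suc k)"
    "m - 2 * 2 ^ k * p \<in> translation_set k \<longleftrightarrow> even m \<and> odd (m div 2 ^ Suc k)"
    "m - (1 + 2 * 2 ^ k * q) \<in> translation_set k \<longleftrightarrow> odd m \<and> odd ((m - 1) div 2 ^ Suc k)"
    using shift[OF assms(1)] shift[OF assms(2), of "m - 1"] unfolding q translation_set_def by auto
  then show ?thesis by (auto simp del: power_Suc)
qed

lemma interval_from_mem_iff:
  fixes n :: int
  assumes "interval_from s h I" and "4 * s = 4 * a + of_int i" "4 * h = of_int j"
    and "4 * (x - a) \<notin> \<int>"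
  shows "x - of_int t / 4 \<in> I \<longleftrightarrow> \<lfloor>4 * (x - a)\<rfloor> - t \<in> {i..<i + j}"
proof -
  have s: "s = a + of_int i / 4" and h: "h = of_int j / 4" using assms by auto
  define y where "y = 4 * (x - a)"
  have ne: "y \<noteq> of_int k" for k using assms(4) unfolding y_def by auto
  have fl: "k \<le> \<lfloor>y\<rfloor> \<longleftrightarrow> of_int k < y" for k
    using ne[of k] by (simp add: le_floor_iff less_le)
  have x: "x = a + y / 4" by (simp add: y_def field_simps)
  have "x - of_int t / 4 \<in> I \<longleftrightarrow> of_int (i + t) < y \<and> y < of_int (i + j + t)"
  proof
    assume "x - of_int t / 4 \<in> I"
    then have "s \<le> x - of_int t / 4 \<and> x - of_int t / 4 \<le> s + h"
      using assms(1) unfolding interval_from_def by auto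
    then have "of_int (i + t) \<le> y \<and> y \<le> of_int (i + j + t)"
      unfolding s h x by (simp add: field_simps)
    then show "of_int (i + t) < y \<and> y < of_int (i + j + t)"
      using ne[of "i + t"] ne[of "i + j + t"] by (simp add: less_le)
  next
    assume "of_int (i + t) < y \<and> y < of_int (i + j + t)"
    then have "x - of_int t / 4 \<in> {s<..<s + h}" 
      unfolding s h x by (simp add: field_simps)
    then show "x - of_int t / 4 \<in> I"
      using assms(1) unfolding interval_from_def by blast
  qed
  also have "\<dots> \<longleftrightarrow> i + t \<le> \<lfloor>y\<rfloor> \<and> \<not> i + j + t \<le> \<lfloor>y\<rfloor>"
    using ne[of "i + j + t"] by (auto simp: fl)
  finally show ?thesis unfolding y_def by auto
qed

text \<open>Away from the points that lie on the grid of quarters through \<open>a\<close>, membership depends only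
  on the cell of the grid, and the tiling of the line reduces to that of the integers.\<close>

lemma tiling_offsets_imp_tiles:
  assumes A: "interval_from a (1/2) A" and B: "interval_from b (1/4) B" and C: "interval_from c (1/4) C"
    and off: "tiling_offsets (4 * (b - a)) (4 * (c - a))"
  shows "tiles_by_translations (A \<union> B \<union> C)"
proof -
  obtain k p q where p: "odd p" and q: "odd q"
    and b: "4 * (b - a) = of_int (2 * 2 ^ k * p)" and c: "4 * (c - a) = of_int (1 + 2 * 2 ^ k * q)"
    using off unfolding tiling_offsets_def by blast
  let ?D = "{0, 1, 2 * 2 ^ k * p, 1 + 2 * 2 ^ k * q}"
  let ?\<Omega> = "A \<union> B \<union> C"
  define N where "N = {x. 4 * (x - a) \<in> \<int>}"
  have "N \<subseteq> (\<lambda>i::int. a + of_int i / 4) ` UNIV"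
  proof
    fix x assume "x \<in> N"
    then obtain i where "4 * (x - a) = of_int i" unfolding N_def by (auto elim: Ints_cases)
    then have "x = a + of_int i / 4" by simp
    then show "x \<in> range (\<lambda>i::int. a + of_int i / 4)" by blast
  qed
  then have "countable N" by (rule countable_subset) simp
  then have null: "S \<in> null_sets lebesgue" if "S \<subseteq> N" for S
    using that by (intro null_sets_completionI countable_imp_null_set_lborel) (rule countable_subset)
  have mem: "x - of_int t / 4 \<in> ?\<Omega> \<longleftrightarrow> \<lfloor>4 * (x - a)\<rfloor> - t \<in> ?D" if "x \<notin> N" for x t
  proof -
    have x: "4 * (x - a) \<notin> \<int>" using that unfolding N_def by simp
    have "x - of_int t / 4 \<in> A \<longleftrightarrow> \<lfloor>4 * (x - a)\<rfloor> - t \<in> {0..<0 + 2}"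
      using x by (intro interval_from_mem_iff[OF A]) auto
    moreover have "x - of_int t / 4 \<in> B \<longleftrightarrow> \<lfloor>4 * (x - a)\<rfloor> - t \<in> {2 * 2 ^ k * p..<2 * 2 ^ k * p + 1}"
      using x b by (intro interval_from_mem_iff[OF B]) auto
    moreover have "x - of_int t / 4 \<in> C \<longleftrightarrow> \<lfloor>4 * (x - a)\<rfloor> - t \<in> {1 + 2 * 2 ^ k * q..<(1 + 2 * 2 ^ k * q) + 1}"
      using x c by (intro interval_from_mem_iff[OF C]) auto
    ultimately show ?thesis by auto
  qed
  let ?T = "(\<lambda>t. of_int t / 4 :: real) ` translation_set k"
  have trans: "x \<in> (+) s ` ?\<Omega> \<longleftrightarrow> x - s \<in> ?\<Omega>" for x s
  proof
    assume "x - s \<in> ?\<Omega>"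
    then have "s + (x - s) \<in> (+) s ` ?\<Omega>" by (rule imageI)
    then show "x \<in> (+) s ` ?\<Omega>" by simp
  qed auto
  show ?thesis
    unfolding tiles_by_translations_def
  proof (intro exI[of _ ?T] conjI ballI impI)
    fix s t assume s: "s \<in> ?T" and t: "t \<in> ?T" and st: "s \<noteq> t"
    show "(+) s ` ?\<Omega> \<inter> (+) t ` ?\<Omega> \<in> null_sets lebesgue"
    proof (intro null subsetI, rule ccontr)
      fix x assume x: "x \<in> (+) s ` ?\<Omega> \<inter> (+) t ` ?\<Omega>" and xN: "x \<notin> N"
      obtain s' t' where s': "s = of_int s' / 4" "s' \<in> translation_set k"
        and t': "t = of_int t' / 4" "t' \<in> translation_set k" using s t by blast
      define m where "m = \<lfloor>4 * (x - a)\<rfloor>"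
      have "m - s' \<in> ?D" "m - t' \<in> ?D"
        using x mem[OF xN] unfolding trans[of x] s' t' m_def Int_iff by blast+
      moreover have "m - (m - s') \<in> translation_set k" "m - (m - t') \<in> translation_set k"
        using s' t' by simp_all
      ultimately have "m - s' = m - t'"
        using translation_set_unique_offset[OF p q, of k m] by blast
      with st s' t' show False by simp
    qed
  next
    show "UNIV - (\<Union>t\<in>?T. (+) t ` ?\<Omega>) \<in> null_sets lebesgue"
    proof (intro null subsetI, rule ccontr)
      fix x assume x: "x \<in> UNIV - (\<Union>t\<in>?T. (+) t ` ?\<Omega>)" and xN: "x \<notin> N"
      define m where "m = \<lfloor>4 * (x - a)\<rfloor>"
      obtain d where d: "d \<in> ?D" "m - d \<in> translation_set k"
        using translation_set_unique_offset[OF p q, of k m] by blast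
      then have "m - (m - d) \<in> ?D" by simp
      then have "x - of_int (m - d) / 4 \<in> ?\<Omega>" using mem[OF xN] unfolding m_def by blast
      then show False using x d(2) unfolding trans[symmetric] by blast
    qed
  qed
qed

section \<open>From a spectrum to a tiling\<close>

theorem mainTheorem3:
  fixes A B C \<Omega> :: "real set"
  assumes "is_interval A" and "is_interval B" and "is_interval C"
    and "A \<inter> B = {}" and "A \<inter> C = {}" and "B \<inter> C = {}"
    and "measure lebesgue A = 1/2" and "measure lebesgue B = 1/4" and "measure lebesgue C = 1/4"
    and "\<Omega> = A \<union> B \<union> C"
    and "spectral_set \<Omega>"
  shows "tiles_by_translations \<Omega>"
proof -
  obtain a where A: "interval_from a (1/2) A" using interval_from_exists[OF assms(1) assms(7)] by auto
  obtain b where B: "interval_from b (1/4) B" using interval_from_exists[OF assms(2) assms(8)] by auto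
  obtain c where C: "interval_from c (1/4) C" using interval_from_exists[OF assms(3) assms(9)] by auto
  have meas: "A \<in> lmeasurable" "B \<in> lmeasurable" "C \<in> lmeasurable"
    using lmeasurable_interval_from[OF A] lmeasurable_interval_from[OF B] lmeasurable_interval_from[OF C]
    by simp_all
  have \<Omega>: "\<Omega> \<in> lmeasurable" using meas assms(10) by auto
  have "measure lebesgue \<Omega> = measure lebesgue (A \<union> B) + measure lebesgue C"
    unfolding assms(10) using meas assms(5,6) by (intro measure_Un3[THEN trans]) (auto simp: Int_Un_distrib2)
  also have "measure lebesgue (A \<union> B) = measure lebesgue A + measure lebesgue B"
    using meas assms(4) by (intro measure_Un3[THEN trans]) auto
  finally have m1: "measure lebesgue \<Omega> = 1" using assms(7-9) by simp
  obtain \<Lambda> where basis: "orthonormal_basis_L2 (lebesgue_on \<Omega>) (exponential_on \<Omega>) \<Lambda>"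
    using assms(11) unfolding spectral_set_def by blast
  define \<alpha> where "\<alpha> = 4 * (b - a)"
  define \<beta> where "\<beta> = 4 * (c - a)"
  have cancel: "cancels \<alpha> \<beta> ((l - m) / 2) \<or> cancels \<beta> \<alpha> ((l - m) / 2)"
    if "l \<in> \<Lambda>" "m \<in> \<Lambda>" "(l - m) / 2 \<notin> \<int>" for l m
  proof -
    have "l \<noteq> m" using that(3) by auto
    then have "0 = L2_inner (lebesgue_on \<Omega>) (exponential_on \<Omega> l) (exponential_on \<Omega> m)"
      using basis that unfolding orthonormal_basis_L2_def by simp
    also have "\<dots> = L2_inner (lebesgue_on \<Omega>) (character l) (character m)"
      unfolding L2_inner_def using \<Omega> m1
      by (intro Bochner_Integration.integral_cong) (auto simp: exponential_on_def character_def)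
    also have "\<dots> = integral \<Omega> (character (l - m))" using L2_inner_character[OF \<Omega>] .
    finally show ?thesis
      using integral_character_eq_0_imp_cancels[OF A B C assms(4-6), of "l - m"] that(3)
      unfolding \<alpha>_def \<beta>_def assms(10) by simp
  qed
  have escape: "\<exists>l\<in>\<Lambda>. (l - z) / 2 \<notin> \<int> \<and> (l - y) / 2 \<notin> \<int>" if "z \<notin> \<Lambda>" for z y
    using assms(10) by (intro spectrum_escapes_two_cosets[OF A _ \<Omega> m1 basis that]) blast
  obtain x where x: "x \<in> \<Lambda>" using escape by blast
  \<comment> \<open>The number \<open>x + 1\<close> lies outside the coset of \<open>x\<close>: either it is a frequency
    itself, or its absence forces another frequency outside that coset.\<close>
  obtain y where y: "y \<in> \<Lambda>" "(y - x) / 2 \<notin> \<int>"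
  proof (cases "x + 1 \<in> \<Lambda>")
    case True
    have "(x + 1 - x) / 2 \<notin> \<int>" by simp
    with True show ?thesis using that by blast
  next
    case False
    then show ?thesis using escape[of "x + 1" x] that by blast
  qed
  have two: "(l - x) / 2 \<in> \<int> \<or> (l - y) / 2 \<in> \<int>" if l: "l \<in> \<Lambda>" for l
  proof (rule ccontr)
    assume "\<not> ?thesis"
    then have n: "(l - x) / 2 \<notin> \<int>" "(l - y) / 2 \<notin> \<int>" by auto
    have e: "(l - x) / 2 - (l - y) / 2 = (y - x) / 2" by (simp add: diff_divide_distrib)
    show False
      using no_three_classes[of \<alpha> \<beta> "(l - x) / 2" "(l - y) / 2"] cancel[OF l x n(1)] cancel[OF l y(1) n(2)]
        cancel[OF y(1) x y(2)] n y(2) unfolding e by blast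
  qed
  have full: "x + 2 * of_int k \<in> \<Lambda>" for k :: int
  proof (rule ccontr)
    assume "x + 2 * of_int k \<notin> \<Lambda>"
    then obtain l where l: "l \<in> \<Lambda>" "(l - (x + 2 * of_int k)) / 2 \<notin> \<int>" "(l - y) / 2 \<notin> \<int>"
      using escape by blast
    have e: "(l - (x + 2 * of_int k)) / 2 = (l - x) / 2 - of_int k" by (simp add: field_simps)
    show False using two[OF l(1)] l(2,3) Ints_diff[OF _ Ints_of_int] unfolding e by blast
  qed
  have "cancels \<alpha> \<beta> ((x - y) / 2 + k) \<or> cancels \<beta> \<alpha> ((x - y) / 2 + k)" if "k \<in> {0, 1, 2}" for k
  proof -
    have "k \<in> \<int>" using that by auto
    then obtain i :: int where i: "k = of_int i" by (auto elim: Ints_cases)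
    have e: "(x + 2 * of_int i - y) / 2 = (x - y) / 2 + k" by (simp add: i field_simps)
    have "(x + 2 * of_int i - y) / 2 \<notin> \<int>"
    proof
      assume "(x + 2 * of_int i - y) / 2 \<in> \<int>"
      then have "of_int i - (x + 2 * of_int i - y) / 2 \<in> \<int>" by (intro Ints_diff) auto
      moreover have "of_int i - (x + 2 * of_int i - y) / 2 = (y - x) / 2" by (simp add: field_simps)
      ultimately show False using y(2) by simp
    qed
    then show ?thesis using cancel[OF full[of i] y(1)] unfolding e by blast
  qed
  then have "tiling_offsets \<alpha> \<beta> \<or> tiling_offsets \<beta> \<alpha>"
    by (rule tiling_offsets_if_three_consecutive)
  then show ?thesis
  proof
    assume "tiling_offsets \<alpha> \<beta>"
    then show ?thesis
      using tiling_offsets_imp_tiles[OF A B C] unfolding \<alpha>_def \<beta>_def assms(10) by blast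
  next
    assume "tiling_offsets \<beta> \<alpha>"
    then have "tiles_by_translations (A \<union> C \<union> B)"
      using tiling_offsets_imp_tiles[OF A C B] unfolding \<alpha>_def \<beta>_def by blast
    then show ?thesis unfolding assms(10) by (simp add: Un_ac)
  qed
qed

end
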